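(* Let $\mathbb{F}=\mathbb{C}$ or $\mathbb{R}$, and let $\mathcal{L}:\mathbb{F}^{q\times q}\to\mathbb{F}^{n\times n}$ be $*$-linear with matricization $L=[L_{ij}]$ and $m=\dim\operatorname{span}\{L_{ij}\}$. Assume $n,q>2$, $m=n+q-2$, and that there are $1\le r\le n$, $1\le s\le q$ and linearly independent $L_1,\ldots,L_m$ and $L_0=\sum_{k=1}^m\alpha_kL_k$ in $\mathbb{F}^{n\times q}$ such that $L$ has the following form: block row $r$ of $L$ equals $(L_1,\ldots,L_{s-1},L_0,L_s,\ldots,L_{q-1})$ (with $L_0$ in block column $s$); block column $s$ of $L$ has, from top to bottom, the entries $L_q,\ldots,L_{q+r-2},L_0,L_{q+r-1},\ldots,L_{q+n-2}$ (with $L_0$ in block row $r$); and all remaining block entries of $L$ equal $L_0$. Assume $\sum_{k=1}^m\alpha_k\neq1$. Then for $\mathbb{F}=\mathbb{C}$ we have $\mathfrak{Y}_{\widehat{A}}=\mathbb{C}^m$, while for $\mathbb{F}=\mathbb{R}$ we have $\mathfrak{Y}_{\widehat{A}}=\mathbb{R}^m$ if and only if $$4\widetilde{\alpha}_1\widetilde{\alpha}_2\le1,\quad\text{with}\quad\widetilde{\alpha}_1=\sum_{k=1}^{q-1}\alpha_k,\quad\widetilde{\alpha}_2=\sum_{k=q}^m\alpha_k.$$ Moreover, (for $\mathbb{F}=\mathbb{R}$) in case $4\widetilde{\alpha}_1\widetilde{\alpha}_2>1$, we have $$\mathfrak{Y}_{\widehat{A}}=\Big\{y\in\mathbb{R}^m:\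 \sum_{k=1}^{q-1}y_k\neq0\ \text{ or }\ \sum_{k=q}^{m}y_k\neq0\ \text{ or }\ \sum_{k=1}^{q-1}|y_k|=0\ \text{ or }\ \sum_{k=q}^m|y_k|=0\Big\}.$$
   Context: Notation: $^*$ denotes the adjoint (the transpose when $\mathbb{F}=\mathbb{R}$); $\otimes$ is the Kronecker product; $\operatorname{vec}$ stacks the columns of a matrix. A linear map $\mathcal{L}$ is $*$-linear if $\mathcal{L}(V^* )=\mathcal{L}(V)^*$ for all $V$. Its matricization is the matrix $L\in\mathbb{F}^{n^2\times q^2}$ with $L\operatorname{vec}(V)=\operatorname{vec}(\mathcal{L}(V))$ for all $V\in\mathbb{F}^{q\times q}$, partitioned as an $n\times q$ block matrix $L=[L_{ij}]$ with blocks $L_{ij}\in\mathbb{F}^{n\times q}$. Since $L_1,\ldots,L_m$ is a basis of $\operatorname{span}\{L_{ij}\}$, there are unique scalars with $L_{ij}=\sum_{k=1}^m\alpha_k^{ij}L_k$. Put $A_k=[\overline{\alpha_k^{ij}}]_{i,j}\in\mathbb{F}^{n\times q}$, define $\widehat{A}\in\mathbb{F}^{m\times nq}$ by $\widehat{A}^*=[\operatorname{vec}(A_1)\ \cdots\ \operatorname{vec}(A_m)]$, and set $\mathfrak{Y}_{\widehat{A}}=\{\widehat{A}(z\otimes x):x\in\mathbb{F}^n,\ z\in\mathbb{F}^q\}$. *)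

theory Defs
  imports
    Jordan_Normal_Form.Schur_Decomposition
    Jordan_Normal_Form.VS_Connect
begin

text \<open>
  Entries of matrices and vectors are indexed from 0, as in \<^theory>\<open>Jordan_Normal_Form.Matrix\<close>.
  The family \<open>L\<^sub>1, \<dots>, L\<^sub>m\<close> is called \<open>M\<close>, to keep it apart from the matricization \<open>L\<close>.
  Blocks \<open>L\<^sub>i\<^sub>j\<close>, the family \<open>M\<close> and scalars such as \<open>\<alpha>\<^sub>k\<close> are
  indexed from 1. The field is \<open>complex\<close> or \<open>real\<close>, both instances of
  \<^class>\<open>conjugatable_field\<close> (for \<open>real\<close>, \<^const>\<open>conjugate\<close> is the identity and
  \<^const>\<open>mat_adjoint\<close> the transpose).
\<close>

definition vec_cols :: "'a mat \<Rightarrow> 'a vec" where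
  "vec_cols A = vec (dim_row A * dim_col A) (\<lambda>p. A $$ (p mod dim_row A, p div dim_row A))"

definition kron_vec :: "'a :: times vec \<Rightarrow> 'a vec \<Rightarrow> 'a vec" where
  "kron_vec z x = vec (dim_vec z * dim_vec x) (\<lambda>p. z $ (p div dim_vec x) * x $ (p mod dim_vec x))"

definition star_linear ::
  "nat \<Rightarrow> nat \<Rightarrow> ('a :: conjugatable_field mat \<Rightarrow> 'a mat) \<Rightarrow> bool" where
  "star_linear q n F \<longleftrightarrow>
     linear_map class_ring (module_mat TYPE('a) q q) (module_mat TYPE('a) n n) F \<and>
     (\<forall>V \<in> carrier_mat q q. F (mat_adjoint V) = mat_adjoint (F V))"

definition is_matricization ::
  "nat \<Rightarrow> nat \<Rightarrow> ('a :: semiring_0 mat \<Rightarrow> 'a mat) \<Rightarrow> 'a mat \<Rightarrow> bool" where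
  "is_matricization q n F L \<longleftrightarrow>
     L \<in> carrier_mat (n^2) (q^2) \<and>
     (\<forall>V \<in> carrier_mat q q. L *\<^sub>v vec_cols V = vec_cols (F V))"

definition block :: "nat \<Rightarrow> nat \<Rightarrow> 'a mat \<Rightarrow> nat \<Rightarrow> nat \<Rightarrow> 'a mat" where
  "block n q L i j = mat n q (\<lambda>(a, b). L $$ ((i - 1) * n + a, (j - 1) * q + b))"

definition blocks :: "nat \<Rightarrow> nat \<Rightarrow> 'a mat \<Rightarrow> 'a mat set" where
  "blocks n q L = {block n q L i j | i j. i \<in> {1..n} \<and> j \<in> {1..q}}"

definition lin_comb :: "nat \<Rightarrow> nat \<Rightarrow> nat \<Rightarrow> (nat \<Rightarrow> 'a :: field) \<Rightarrow> (nat \<Rightarrow> 'a mat) \<Rightarrow> 'a mat" where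
  "lin_comb n q m c M = finsum (module_mat TYPE('a) n q) (\<lambda>k. c k \<cdot>\<^sub>m M k) {1..m}"

definition dim_span_mat :: "nat \<Rightarrow> nat \<Rightarrow> 'a :: field mat set \<Rightarrow> nat" where
  "dim_span_mat n q S =
     vectorspace.dim class_ring
       (module.span_vs class_ring (module_mat TYPE('a) n q) S)"

text \<open>Injectivity is required because \<^const>\<open>module.lin_dep\<close> speaks about sets, not families.\<close>

definition lin_indpt_family :: "nat \<Rightarrow> nat \<Rightarrow> nat \<Rightarrow> (nat \<Rightarrow> 'a :: field mat) \<Rightarrow> bool" where
  "lin_indpt_family n q m M \<longleftrightarrow>
     M ` {1..m} \<subseteq> carrier_mat n q \<and> inj_on M {1..m} \<and>
     \<not> module.lin_dep class_ring (module_mat TYPE('a) n q) (M ` {1..m})"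

definition cross_form ::
  "nat \<Rightarrow> nat \<Rightarrow> nat \<Rightarrow> nat \<Rightarrow> 'a mat \<Rightarrow> 'a mat \<Rightarrow> (nat \<Rightarrow> 'a mat) \<Rightarrow> bool" where
  "cross_form n q r s L L0 M \<longleftrightarrow>
     (\<forall>j \<in> {1..q}. block n q L r j = (if j < s then M j else if j = s then L0 else M (j - 1))) \<and>
     (\<forall>i \<in> {1..n}. block n q L i s =
        (if i < r then M (q + i - 1) else if i = r then L0 else M (q + i - 2))) \<and>
     (\<forall>i \<in> {1..n}. \<forall>j \<in> {1..q}. i \<noteq> r \<longrightarrow> j \<noteq> s \<longrightarrow> block n q L i j = L0)"

text \<open>In \<open>coef k i j\<close> the arguments stand for \<open>\<alpha>\<^sub>k\<^sup>i\<^sup>j\<close>.\<close>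

definition coefficients_of_blocks ::
  "nat \<Rightarrow> nat \<Rightarrow> nat \<Rightarrow> 'a :: field mat \<Rightarrow> (nat \<Rightarrow> 'a mat) \<Rightarrow> (nat \<Rightarrow> nat \<Rightarrow> nat \<Rightarrow> 'a) \<Rightarrow> bool" where
  "coefficients_of_blocks n q m L M coef \<longleftrightarrow>
     (\<forall>i \<in> {1..n}. \<forall>j \<in> {1..q}. block n q L i j = lin_comb n q m (\<lambda>k. coef k i j) M)"

definition A_mat ::
  "nat \<Rightarrow> nat \<Rightarrow> (nat \<Rightarrow> nat \<Rightarrow> nat \<Rightarrow> 'a :: conjugatable_field) \<Rightarrow> nat \<Rightarrow> 'a mat" where
  "A_mat n q coef k = mat n q (\<lambda>(i, j). conjugate (coef k (Suc i) (Suc j)))"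

definition A_hat ::
  "nat \<Rightarrow> nat \<Rightarrow> nat \<Rightarrow> (nat \<Rightarrow> nat \<Rightarrow> nat \<Rightarrow> 'a :: conjugatable_field) \<Rightarrow> 'a mat" where
  "A_hat n q m coef =
     mat_adjoint (mat_of_cols (n * q) (map (\<lambda>k. vec_cols (A_mat n q coef k)) [1..<Suc m]))"

definition Y_set :: "nat \<Rightarrow> nat \<Rightarrow> 'a :: semiring_0 mat \<Rightarrow> 'a vec set" where
  "Y_set n q A = {A *\<^sub>v kron_vec z x | x z. x \<in> carrier_vec n \<and> z \<in> carrier_vec q}"

definition cross_setting ::
  "nat \<Rightarrow> nat \<Rightarrow> nat \<Rightarrow> nat \<Rightarrow> nat \<Rightarrow> ('a :: conjugatable_field mat \<Rightarrow> 'a mat) \<Rightarrow> 'a mat \<Rightarrow>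
   'a mat \<Rightarrow> (nat \<Rightarrow> 'a mat) \<Rightarrow> (nat \<Rightarrow> 'a) \<Rightarrow> (nat \<Rightarrow> nat \<Rightarrow> nat \<Rightarrow> 'a) \<Rightarrow> bool" where
  "cross_setting n q m r s F L L0 M \<alpha> coef \<longleftrightarrow>
     star_linear q n F \<and>
     is_matricization q n F L \<and>
     m = dim_span_mat n q (blocks n q L) \<and>
     lin_indpt_family n q m M \<and>
     L0 = lin_comb n q m \<alpha> M \<and>
     cross_form n q r s L L0 M \<and>
     (\<Sum>k=1..m. \<alpha> k) \<noteq> 1 \<and>
     coefficients_of_blocks n q m L M coef"

end

theory Submission
  imports Defs
begin

text \<open>
  The \<open>k\<close>-th entry of \<open>A_hat *\<^sub>v kron_vec z x\<close> is
  \<open>\<Sum> i j. coef k i j * x\<^sub>i * z\<^sub>j\<close>; the two conjugations, in \<^const>\<open>A_mat\<close> and in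
  \<^const>\<open>mat_adjoint\<close>, cancel. Linear independence of \<open>M\<close> makes the coefficients unique, so
  they can be read off from the cross shape of \<open>L\<close>: they are unit vectors along block row
  \<open>r\<close> and block column \<open>s\<close>, and \<open>\<alpha>\<close> in all other blocks and at the crossing. Put
  \<open>a = x\<^sub>r\<close>, \<open>b = z\<^sub>s\<close>, let \<open>u\<close> be \<open>z\<close> without entry \<open>s\<close>, let
  \<open>v\<close> be \<open>x\<close> without entry \<open>r\<close>, and let \<open>I = {1..q-1}\<close>,
  \<open>J = {q..m}\<close>. The image \<open>y\<close> is then given by the cross equations
  (\<open>cross_Y_set\<close>)

  \<open>y k = a * u k + \<alpha> k * S\<close> on \<open>I\<close>, \<open>y k = b * v k + \<alpha> k * S\<close> on \<open>J\<close>,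
  where \<open>S = a * b + sum u I * sum v J\<close>.

  If \<open>p = a * b\<close> is nonzero, \<open>u\<close> and \<open>v\<close> are determined by \<open>y\<close> and \<open>S\<close>,
  and the definition of \<open>S\<close> becomes the quadratic equation
  \<open>p\<^sup>2 - S p + c S = 0\<close> with
  \<open>c S = (sum y I - sum \<alpha> I * S) * (sum y J - sum \<alpha> J * S)\<close>.
  Conversely every solution with \<open>p \<noteq> 0\<close> gives a preimage of \<open>y\<close>
  (\<open>cross_imageI\<close>). Over the complex numbers \<open>S = 1\<close> always works, because the two
  roots then have sum \<open>1\<close> and cannot both vanish.

  Over the reals one needs an \<open>S\<close> with discriminant
  \<open>D S = S\<^sup>2 - 4 * c S \<ge> 0\<close> for which not both roots vanish. As a polynomial in \<open>S\<close>,
  \<open>D\<close> has leading coefficient \<open>1 - 4 * sum \<alpha> I * sum \<alpha> J\<close>. If this is positive, a large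
  \<open>S\<close> works; if it is zero, \<open>D\<close> is affine and a direct argument works
  (\<open>cross_image_real_full\<close>). If it is negative, \<open>D\<close> is a concave parabola, whose maximum
  has the sign of
  \<open>(sum \<alpha> I * sum y J - sum \<alpha> J * sum y I)\<^sup>2 + sum y I * sum y J\<close>; this settles all
  \<open>y\<close> with a nonzero partial sum (\<open>cross_image_real_nonzero_sum\<close>). If both partial sums
  vanish, the equations force \<open>S = 0\<close> and \<open>a * b = 0\<close>, so \<open>y\<close> vanishes on
  \<open>I\<close> or on \<open>J\<close> (\<open>cross_image_real_zero_sums\<close>).
\<close>

section \<open>Uniqueness of coordinates\<close>

text \<open>Entrywise, a linear combination of matrices is an ordinary sum of scalars, which is
  easier to handle than \<^const>\<open>finsum\<close>.\<close>

lemma lin_comb_eq_mat: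
  assumes "M ` {1..m} \<subseteq> carrier_mat n q"
  shows "lin_comb n q m c M = mat n q (\<lambda>(i, j). \<Sum>k=1..m. c k * M k $$ (i, j))"
proof -
  interpret abelian_group "module_mat TYPE('a) n q" by (rule abelian_group_mat)
  have "finsum (module_mat TYPE('a) n q) (\<lambda>k. c k \<cdot>\<^sub>m M k) K
      = mat n q (\<lambda>(i, j). \<Sum>k\<in>K. c k * M k $$ (i, j))" if "finite K" "K \<subseteq> {1..m}" for K
    using that
  proof (induction K rule: finite_induct)
    case empty
    show ?case by (auto simp: module_mat_simps)
  next
    case (insert l K)
    have carr: "\<And>k. k \<in> insert l K \<Longrightarrow> M k \<in> carrier_mat n q"
      using assms insert.prems by blast
    have "finsum (module_mat TYPE('a) n q) (\<lambda>k. c k \<cdot>\<^sub>m M k) (insert l K)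
        = c l \<cdot>\<^sub>m M l + finsum (module_mat TYPE('a) n q) (\<lambda>k. c k \<cdot>\<^sub>m M k) K"
      using insert.hyps carr by (subst finsum_insert) (auto simp: module_mat_simps)
    then show ?case
      using insert carr[of l] by (auto intro!: eq_matI)
  qed
  then show ?thesis by (simp add: lin_comb_def)
qed

text \<open>Linear dependence is stated for sets of vectors, with coefficients attached to the
  vectors. As \<open>M\<close> is injective, coefficients attached to indices can be transported.\<close>

lemma lin_comb_eq_zeroD:
  assumes ind: "lin_indpt_family n q m M" and zero: "lin_comb n q m c M = 0\<^sub>m n q"
    and k: "k \<in> {1..m}"
  shows "c k = 0"
proof (rule ccontr)
  assume nz: "c k \<noteq> 0"
  interpret vectorspace "class_ring :: 'a ring" "module_mat TYPE('a) n q" by (rule matrix_vs)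
  let ?K = "{1..m}"
  define a where "a = c \<circ> inv_into ?K M"
  have carr: "M ` ?K \<subseteq> carrier_mat n q" and inj: "inj_on M ?K" and nd: "\<not> lin_dep (M ` ?K)"
    using ind by (auto simp: lin_indpt_family_def)
  have a: "a (M l) = c l" if "l \<in> ?K" for l
    using that inj by (simp add: a_def)
  have "lincomb a (M ` ?K) = finsum (module_mat TYPE('a) n q) (\<lambda>l. a (M l) \<cdot>\<^sub>m M l) ?K"
    unfolding lincomb_def
    by (subst M.finsum_reindex) (use carr inj in \<open>auto simp: module_mat_simps\<close>)
  also have "\<dots> = lin_comb n q m c M"
    unfolding lin_comb_def
    by (rule M.finsum_cong') (use a carr in \<open>auto simp: module_mat_simps\<close>)
  finally have "lincomb a (M ` ?K) = \<zero>\<^bsub>module_mat TYPE('a) n q\<^esub>"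
    using zero by (simp add: module_mat_simps)
  moreover have "a (M k) \<noteq> \<zero>\<^bsub>class_ring\<^esub>"
    using a[OF k] nz by (simp add: class_ring_simps)
  ultimately have "lin_dep (M ` ?K)"
    unfolding lin_dep_def using k
    by (intro exI[of _ "M ` ?K"] exI[of _ a] exI[of _ "M k"]) (auto simp: class_ring_simps)
  with nd show False by simp
qed

lemma lin_comb_cancel:
  assumes ind: "lin_indpt_family n q m M" and eq: "lin_comb n q m c M = lin_comb n q m d M"
    and k: "k \<in> {1..m}"
  shows "c k = d k"
proof -
  have carr: "M ` {1..m} \<subseteq> carrier_mat n q" using ind by (simp add: lin_indpt_family_def)
  have "lin_comb n q m (\<lambda>l. c l - d l) M = 0\<^sub>m n q"
  proof (rule eq_matI)
    fix i j assume "i < dim_row (0\<^sub>m n q :: 'a mat)" "j < dim_col (0\<^sub>m n q :: 'a mat)"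
    moreover have "lin_comb n q m c M $$ (i, j) = lin_comb n q m d M $$ (i, j)"
      using eq by simp
    ultimately show "lin_comb n q m (\<lambda>l. c l - d l) M $$ (i, j) = 0\<^sub>m n q $$ (i, j)"
      by (simp add: lin_comb_eq_mat[OF carr] sum_subtractf left_diff_distrib)
  qed (simp_all add: lin_comb_eq_mat[OF carr])
  from lin_comb_eq_zeroD[OF ind this k] show ?thesis by simp
qed

lemma lin_comb_unit:
  assumes carr: "M ` {1..m} \<subseteq> carrier_mat n q" and l: "l \<in> {1..m}"
  shows "lin_comb n q m (\<lambda>k. if k = l then 1 else 0) M = M l"
proof -
  have "M l \<in> carrier_mat n q" using carr l by auto
  then show ?thesis
    using l by (auto simp: lin_comb_eq_mat[OF carr] if_distrib[of "\<lambda>t. t * _"] cong: if_cong intro!: eq_matI)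
qed

section \<open>The bilinear map in coordinates\<close>

text \<open>The column-major position \<open>p = j * n + i\<close> stands for the matrix entry \<open>(i, j)\<close>.\<close>

lemma sum_mod_div:
  fixes f :: "nat \<Rightarrow> nat \<Rightarrow> 'a :: comm_monoid_add"
  shows "(\<Sum>p<n * q. f (p mod n) (p div n)) = (\<Sum>i<n. \<Sum>j<q. f i j)"
proof -
  have "(\<Sum>p<n * q. f (p mod n) (p div n)) = (\<Sum>j<q. \<Sum>p=j*n..<j*n+n. f (p mod n) (p div n))"
    by (simp add: sum.nat_group mult.commute)
  also have "\<dots> = (\<Sum>j<q. \<Sum>i<n. f i j)"
  proof (rule sum.cong[OF refl])
    fix j
    have "(\<Sum>p=j*n..<j*n+n. f (p mod n) (p div n)) = (\<Sum>i=0..<n. f ((i + j*n) mod n) ((i + j*n) div n))"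
      using sum.shift_bounds_nat_ivl[of "\<lambda>p. f (p mod n) (p div n)" 0 "j*n" n]
      by (simp add: add.commute)
    also have "\<dots> = (\<Sum>i<n. f i j)"
      by (intro sum.cong) auto
    finally show "(\<Sum>p=j*n..<j*n+n. f (p mod n) (p div n)) = (\<Sum>i<n. f i j)" .
  qed
  also have "\<dots> = (\<Sum>i<n. \<Sum>j<q. f i j)"
    by (rule sum.swap)
  finally show ?thesis .
qed

lemma A_hat_carrier: "A_hat n q m coef \<in> carrier_mat m (n * q)"
  by (auto simp: A_hat_def mat_adjoint_def)

lemma A_hat_index:
  assumes "k < m" and "p < n * q"
  shows "A_hat n q m coef $$ (k, p) = coef (Suc k) (Suc (p mod n)) (Suc (p div n))"
proof -
  have "p mod n < n" using assms(2) by (cases n) auto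
  moreover have "p div n < q" using assms(2) by (simp add: less_mult_imp_div_less mult.commute)
  ultimately show ?thesis
    using assms by (simp add: A_hat_def mat_adjoint_def mat_of_rows_index mat_of_cols_index
        vec_cols_def A_mat_def del: upt_Suc)
qed

lemma A_hat_kron_index:
  assumes x: "x \<in> carrier_vec n" and z: "z \<in> carrier_vec q" and k: "k \<in> {1..m}"
  shows "(A_hat n q m coef *\<^sub>v kron_vec z x) $ (k - 1)
    = (\<Sum>i=1..n. \<Sum>j=1..q. coef k i j * (x $ (i - 1) * z $ (j - 1)))"
proof -
  have k': "k - 1 < m" "Suc (k - 1) = k" using k by auto
  have "(A_hat n q m coef *\<^sub>v kron_vec z x) $ (k - 1)
    = (\<Sum>p<n * q. A_hat n q m coef $$ (k - 1, p) * kron_vec z x $ p)"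
    using A_hat_carrier[of n q m coef] x z k'
    by (simp add: scalar_prod_def kron_vec_def mult.commute lessThan_atLeast0)
  also have "\<dots> = (\<Sum>p<n * q. coef k (Suc (p mod n)) (Suc (p div n)) * (x $ (p mod n) * z $ (p div n)))"
    using x z k' by (intro sum.cong) (auto simp: A_hat_index kron_vec_def mult.commute)
  also have "\<dots> = (\<Sum>i<n. \<Sum>j<q. coef k (Suc i) (Suc j) * (x $ i * z $ j))"
    by (rule sum_mod_div)
  also have "\<dots> = (\<Sum>i=1..n. \<Sum>j=1..q. coef k i j * (x $ (i - 1) * z $ (j - 1)))"
    by (simp add: sum.atLeast1_atMost_eq)
  finally show ?thesis .
qed

text \<open>Block row \<open>r\<close> and block column \<open>s\<close> list the basis with a gap at the crossing.
  \<open>skip s\<close> is the increasing enumeration of the positive integers other than \<open>s\<close>.\<close>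

definition skip :: "nat \<Rightarrow> nat \<Rightarrow> nat" where
  "skip s k = (if k < s then k else k + 1)"

lemma bij_betw_skip:
  assumes "1 \<le> s" "s \<le> q"
  shows "bij_betw (skip s) {1..q-1} ({1..q} - {s})"
  by (rule bij_betw_byWitness[where f' = "\<lambda>j. if j < s then j else j - 1"])
     (use assms in \<open>auto simp: skip_def\<close>)

lemma sum_split_skip:
  fixes f :: "nat \<Rightarrow> 'a :: comm_monoid_add"
  assumes "1 \<le> s" "s \<le> q"
  shows "(\<Sum>j=1..q. f j) = f s + (\<Sum>k=1..q-1. f (skip s k))"
proof -
  have "(\<Sum>j=1..q. f j) = f s + sum f ({1..q} - {s})"
    using assms by (intro sum.remove) auto
  also have "sum f ({1..q} - {s}) = (\<Sum>k=1..q-1. f (skip s k))"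
    by (rule sum.reindex_bij_betw[OF bij_betw_skip[OF assms], symmetric])
  finally show ?thesis .
qed

text \<open>The vectors are functions here, so that the cross equations are symmetric in the two
  index sets and free of index shifts.\<close>

definition cross_image :: "nat set \<Rightarrow> nat set \<Rightarrow> (nat \<Rightarrow> 'a :: field) \<Rightarrow> (nat \<Rightarrow> 'a) set" where
  "cross_image I J \<alpha> = {y. \<exists>a b u v.
     (\<forall>k\<in>I. y k = a * u k + \<alpha> k * (a * b + sum u I * sum v J)) \<and>
     (\<forall>k\<in>J. y k = b * v k + \<alpha> k * (a * b + sum u I * sum v J))}"

text \<open>Each block is either a member of \<open>M\<close> or \<open>L0\<close>, and thus has an evident
  expansion in \<open>M\<close>, which by linear independence is the only one.\<close>

lemma cross_coefficients:
  assumes set: "cross_setting n q m r s F L L0 M \<alpha> coef"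
    and m: "m = n + q - 2" and n: "n > 2" and q: "q > 2"
    and r: "1 \<le> r" "r \<le> n" and s: "1 \<le> s" "s \<le> q" and k: "k \<in> {1..m}"
  shows "l \<in> {1..q-1} \<Longrightarrow> coef k r (skip s l) = (if k = l then 1 else 0)"
    and "l \<in> {1..n-1} \<Longrightarrow> coef k (skip r l) s = (if k = q - 1 + l then 1 else 0)"
    and "coef k r s = \<alpha> k"
    and "i \<in> {1..n-1} \<Longrightarrow> j \<in> {1..q-1} \<Longrightarrow> coef k (skip r i) (skip s j) = \<alpha> k"
proof -
  have ind: "lin_indpt_family n q m M" and L0: "L0 = lin_comb n q m \<alpha> M"
    and cf: "cross_form n q r s L L0 M"
    and coef: "coefficients_of_blocks n q m L M coef"
    using set by (auto simp: cross_setting_def)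
  have carr: "M ` {1..m} \<subseteq> carrier_mat n q" using ind by (simp add: lin_indpt_family_def)
  have eq_unit: "coef k i j = (if k = l then 1 else 0)"
    if "block n q L i j = M l" "i \<in> {1..n}" "j \<in> {1..q}" "l \<in> {1..m}" for i j l
  proof -
    have "lin_comb n q m (\<lambda>k. coef k i j) M = lin_comb n q m (\<lambda>k. if k = l then 1 else 0) M"
      using that coef lin_comb_unit[OF carr] by (simp add: coefficients_of_blocks_def)
    from lin_comb_cancel[OF ind this k] show ?thesis .
  qed
  have eq_alpha: "coef k i j = \<alpha> k"
    if "block n q L i j = L0" "i \<in> {1..n}" "j \<in> {1..q}" for i j
  proof -
    have "lin_comb n q m (\<lambda>k. coef k i j) M = lin_comb n q m \<alpha> M"
      using that coef L0 by (simp add: coefficients_of_blocks_def)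
    from lin_comb_cancel[OF ind this k] show ?thesis .
  qed
  show "coef k r (skip s l) = (if k = l then 1 else 0)" if l: "l \<in> {1..q-1}"
  proof (rule eq_unit)
    have "skip s l \<in> {1..q}" using l by (auto simp: skip_def)
    then show "block n q L r (skip s l) = M l"
      using cf by (auto simp: cross_form_def skip_def)
  qed (use l m n r in \<open>auto simp: skip_def\<close>)
  show "coef k (skip r l) s = (if k = q - 1 + l then 1 else 0)" if l: "l \<in> {1..n-1}"
  proof (rule eq_unit)
    have "skip r l \<in> {1..n}" using l by (auto simp: skip_def)
    then have "block n q L (skip r l) s
      = (if skip r l < r then M (q + skip r l - 1) else if skip r l = r then L0 else M (q + skip r l - 2))"
      using cf unfolding cross_form_def by blast
    also have "\<dots> = M (q - 1 + l)"
      using q by (auto simp: skip_def numeral_2_eq_2)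
    finally show "block n q L (skip r l) s = M (q - 1 + l)" .
  qed (use l m q s in \<open>auto simp: skip_def\<close>)
  show "coef k r s = \<alpha> k"
    using cf r s by (intro eq_alpha) (auto simp: cross_form_def)
  show "coef k (skip r i) (skip s j) = \<alpha> k" if "i \<in> {1..n-1}" "j \<in> {1..q-1}"
  proof (rule eq_alpha)
    have "skip r i \<in> {1..n}" "skip s j \<in> {1..q}" "skip r i \<noteq> r" "skip s j \<noteq> s"
      using that by (auto simp: skip_def)
    then show "block n q L (skip r i) (skip s j) = L0" "skip r i \<in> {1..n}" "skip s j \<in> {1..q}"
      using cf by (auto simp: cross_form_def)
  qed
qed

lemma sum_shift_tail:
  fixes f :: "nat \<Rightarrow> 'a :: comm_monoid_add"
  assumes "n > 2" and "q > 2"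
  shows "(\<Sum>k=q..n+q-2. f k) = (\<Sum>l=1..n-1. f (q - 1 + l))"
  by (rule sum.reindex_bij_witness[where i = "\<lambda>l. q - 1 + l" and j = "\<lambda>k. k - (q - 1)"])
     (use assms in auto)

text \<open>The double sum over blocks splits into the crossing, the row, the column and the rest.
  Crossing and rest all carry the coefficient \<open>\<alpha> k\<close>, which yields the common factor
  \<open>S\<close>; of the row and the column at most one entry, the one holding \<open>M k\<close>,
  survives.\<close>

lemma cross_kron_index:
  fixes \<alpha> :: "nat \<Rightarrow> 'a :: conjugatable_field"
  assumes set: "cross_setting n q m r s F L L0 M \<alpha> coef"
    and m: "m = n + q - 2" and n: "n > 2" and q: "q > 2"
    and r: "1 \<le> r" "r \<le> n" and s: "1 \<le> s" "s \<le> q"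
    and x: "x \<in> carrier_vec n" and z: "z \<in> carrier_vec q" and k: "k \<in> {1..m}"
    and u: "\<And>k. k \<in> {1..q-1} \<Longrightarrow> u k = z $ (skip s k - 1)"
    and v: "\<And>k. k \<in> {q..m} \<Longrightarrow> v k = x $ (skip r (k - (q - 1)) - 1)"
  shows "(A_hat n q m coef *\<^sub>v kron_vec z x) $ (k - 1)
    = (if k < q then x $ (r - 1) * u k else z $ (s - 1) * v k)
      + \<alpha> k * (x $ (r - 1) * z $ (s - 1) + sum u {1..q-1} * sum v {q..m})"
proof -
  let ?a = "x $ (r - 1)" and ?b = "z $ (s - 1)"
  let ?w = "\<lambda>i. x $ (skip r i - 1)"
  note coef = cross_coefficients[OF set m n q r s k]
  have sumv: "sum v {q..m} = (\<Sum>l=1..n-1. ?w l)"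
    unfolding m sum_shift_tail[OF n q]
  proof (rule sum.cong[OF refl])
    fix l assume "l \<in> {1..n-1}"
    then have "q - 1 + l \<in> {q..m}"
      using n q unfolding m atLeastAtMost_iff by linarith
    from v[OF this] show "v (q - 1 + l) = ?w l" by simp
  qed
  have "(A_hat n q m coef *\<^sub>v kron_vec z x) $ (k - 1)
    = coef k r s * (?a * ?b) + (\<Sum>l=1..q-1. coef k r (skip s l) * (?a * z $ (skip s l - 1)))
      + (\<Sum>i=1..n-1. coef k (skip r i) s * (?w i * ?b)
          + (\<Sum>j=1..q-1. coef k (skip r i) (skip s j) * (?w i * z $ (skip s j - 1))))"
    unfolding A_hat_kron_index[OF x z k] sum_split_skip[OF r] sum_split_skip[OF s] ..
  also have "\<dots> = \<alpha> k * (?a * ?b) + (\<Sum>l=1..q-1. if k = l then ?a * u l else 0)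
      + ((\<Sum>i=1..n-1. if k = q - 1 + i then ?w i * ?b else 0)
          + (\<Sum>i=1..n-1. \<Sum>j=1..q-1. \<alpha> k * (?w i * u j)))"
    unfolding sum.distrib
    by (intro arg_cong2[where f = "(+)"] sum.cong refl) (auto simp: coef u)
  also have "(\<Sum>i=1..n-1. \<Sum>j=1..q-1. \<alpha> k * (?w i * u j)) = \<alpha> k * (sum u {1..q-1} * sum v {q..m})"
    unfolding sumv by (simp add: sum_product sum_distrib_left sum_distrib_right mult_ac sum.swap[of _ "{1..q-1}"])
  also have "(\<Sum>l=1..q-1. if k = l then ?a * u l else 0) = (if k < q then ?a * u k else 0)"
    using k by auto
  also have "(\<Sum>i=1..n-1. if k = q - 1 + i then ?w i * ?b else 0) = (if k < q then 0 else ?b * v k)"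
  proof (cases "k < q")
    case True
    then show ?thesis by (auto intro!: sum.neutral)
  next
    case False
    have "(\<Sum>i=1..n-1. if k = q - 1 + i then ?w i * ?b else 0)
        = (\<Sum>i=1..n-1. if k - (q - 1) = i then ?w i * ?b else 0)"
      using False q by (intro sum.cong) auto
    also have "\<dots> = ?b * v k"
      using False k q m n v[of k] by (auto simp: mult.commute)
    finally show ?thesis using False by simp
  qed
  finally show ?thesis by (simp add: algebra_simps)
qed

lemma cross_Y_set:
  fixes \<alpha> :: "nat \<Rightarrow> 'a :: conjugatable_field"
  assumes set: "cross_setting n q m r s F L L0 M \<alpha> coef"
    and m: "m = n + q - 2" and n: "n > 2" and q: "q > 2"
    and r: "1 \<le> r" "r \<le> n" and s: "1 \<le> s" "s \<le> q"
  shows "Y_set n q (A_hat n q m coef)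
    = {y \<in> carrier_vec m. (\<lambda>k. y $ (k - 1)) \<in> cross_image {1..q-1} {q..m} \<alpha>}"
    (is "?Y = ?C")
proof (intro equalityI subsetI)
  fix y assume "y \<in> ?Y"
  then obtain x z where x: "x \<in> carrier_vec n" and z: "z \<in> carrier_vec q"
    and y: "y = A_hat n q m coef *\<^sub>v kron_vec z x" by (auto simp: Y_set_def)
  note * = cross_kron_index[OF set m n q r s x z, where u = "\<lambda>k. z $ (skip s k - 1)"
      and v = "\<lambda>k. x $ (skip r (k - (q - 1)) - 1)", folded y]
  have "y \<in> carrier_vec m"
    unfolding y using A_hat_carrier[of n q m coef] by (simp add: carrier_vecI)
  moreover have "(\<lambda>k. y $ (k - 1)) \<in> cross_image {1..q-1} {q..m} \<alpha>"
    unfolding cross_image_def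
    by (intro CollectI exI[of _ "x $ (r - 1)"] exI[of _ "z $ (s - 1)"]
        exI[of _ "\<lambda>k. z $ (skip s k - 1)"] exI[of _ "\<lambda>k. x $ (skip r (k - (q - 1)) - 1)"]
        conjI ballI; subst *) (use m n q in auto)
  ultimately show "y \<in> ?C" by simp
next
  fix y assume "y \<in> ?C"
  then obtain a b u v where y: "y \<in> carrier_vec m"
    and I: "\<And>k. k \<in> {1..q-1} \<Longrightarrow>
      y $ (k - 1) = a * u k + \<alpha> k * (a * b + sum u {1..q-1} * sum v {q..m})"
    and J: "\<And>k. k \<in> {q..m} \<Longrightarrow>
      y $ (k - 1) = b * v k + \<alpha> k * (a * b + sum u {1..q-1} * sum v {q..m})"
    by (auto simp: cross_image_def)
  define z where "z = vec q (\<lambda>j. if j + 1 = s then b else u (if j + 1 < s then j + 1 else j))"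
  define x where "x = vec n (\<lambda>i. if i + 1 = r then a else v (q - 1 + (if i + 1 < r then i + 1 else i)))"
  have z: "z \<in> carrier_vec q" and x: "x \<in> carrier_vec n" by (auto simp: z_def x_def)
  have zs: "z $ (s - 1) = b" and xr: "x $ (r - 1) = a" using r s by (auto simp: z_def x_def)
  have u: "u k = z $ (skip s k - 1)" if "k \<in> {1..q-1}" for k
    using that s by (auto simp: z_def skip_def)
  have v: "v k = x $ (skip r (k - (q - 1)) - 1)" if "k \<in> {q..m}" for k
    using that r m q n by (auto simp: x_def skip_def)
  have "y = A_hat n q m coef *\<^sub>v kron_vec z x"
  proof (rule eq_vecI)
    fix i assume "i < dim_vec (A_hat n q m coef *\<^sub>v kron_vec z x)"
    then have i: "Suc i \<in> {1..m}" using A_hat_carrier[of n q m coef] by simp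
    have "(A_hat n q m coef *\<^sub>v kron_vec z x) $ (Suc i - 1)
      = (if Suc i < q then a * u (Suc i) else b * v (Suc i))
        + \<alpha> (Suc i) * (a * b + sum u {1..q-1} * sum v {q..m})"
      by (rule cross_kron_index[OF set m n q r s x z i, unfolded zs xr]) (fact u, fact v)
    then show "y $ i = (A_hat n q m coef *\<^sub>v kron_vec z x) $ i"
      using I[of "Suc i"] J[of "Suc i"] i by (cases "Suc i < q") auto
  qed (use y A_hat_carrier[of n q m coef] in auto)
  then show "y \<in> ?Y" using x z by (auto simp: Y_set_def)
qed

section \<open>Solving the cross equations\<close>

text \<open>Of nonzero \<open>a\<close> and \<open>b\<close> only the product matters, as scaling
  \<open>(a, u)\<close> by \<open>(t, 1/t)\<close> and \<open>(b, v)\<close> by \<open>(1/t, t)\<close> preserves the cross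
  equations. Hence \<open>a = p\<close>, \<open>b = 1\<close> may be taken, and \<open>u\<close>, \<open>v\<close>
  are solved for.\<close>

lemma cross_imageI:
  fixes \<alpha> :: "nat \<Rightarrow> 'a :: field"
  assumes p: "p \<noteq> 0"
    and root: "p\<^sup>2 - S * p + (sum y I - sum \<alpha> I * S) * (sum y J - sum \<alpha> J * S) = 0"
  shows "y \<in> cross_image I J \<alpha>"
proof -
  define X Y where "X = sum y I - sum \<alpha> I * S" and "Y = sum y J - sum \<alpha> J * S"
  define u where "u k = (y k - \<alpha> k * S) / p" for k
  define v where "v k = y k - \<alpha> k * S" for k
  have sums: "sum u I = X / p" "sum v J = Y"
    by (simp_all add: u_def v_def X_def Y_def sum_divide_distrib[symmetric] sum_subtractf sum_distrib_right)
  have "p * 1 + sum u I * sum v J = (p\<^sup>2 + X * Y) / p"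
    unfolding sums using p by (simp add: field_simps power2_eq_square)
  also have "p\<^sup>2 + X * Y = S * p"
    using root by (simp add: X_def Y_def algebra_simps)
  also have "S * p / p = S" using p by simp
  finally have "p * 1 + sum u I * sum v J = S" .
  then show ?thesis
    unfolding cross_image_def
    by (intro CollectI exI[of _ p] exI[of _ 1] exI[of _ u] exI[of _ v])
       (use p in \<open>auto simp: u_def v_def\<close>)
qed

text \<open>For \<open>S = 1\<close> the two roots of the quadratic equation are \<open>(1 + d) / 2\<close> and
  \<open>(1 - d) / 2\<close>; their sum is \<open>1\<close>, so one of them is nonzero.\<close>

lemma cross_image_complex: "(y :: nat \<Rightarrow> complex) \<in> cross_image I J \<alpha>"
proof -
  define c where "c = (sum y I - sum \<alpha> I) * (sum y J - sum \<alpha> J)"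
  define d where "d = csqrt (1 - 4 * c)"
  have d: "d\<^sup>2 = 1 - 4 * c" by (simp add: d_def)
  have root: "((1 + e) / 2)\<^sup>2 - 1 * ((1 + e) / 2) + c = 0" if "e\<^sup>2 = 1 - 4 * c" for e
  proof -
    have "((1 + e) / 2)\<^sup>2 - 1 * ((1 + e) / 2) = (e\<^sup>2 - 1) / 4"
      by (simp add: power2_eq_square field_simps)
    then show ?thesis by (simp only: that) simp
  qed
  have "1 + d \<noteq> 0 \<or> 1 + (- d) \<noteq> 0" by (auto simp: add_eq_0_iff)
  then obtain e where "e\<^sup>2 = 1 - 4 * c" "1 + e \<noteq> 0" using d by (metis power2_minus)
  with root[of e] show ?thesis
    by (intro cross_imageI[of "(1 + e) / 2" 1]) (auto simp: c_def)
qed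

text \<open>Both roots vanish only if their sum \<open>S\<close> and their product \<open>c\<close> do.\<close>

lemma real_quadratic_nonzero_root:
  fixes S c :: real
  assumes "S\<^sup>2 \<ge> 4 * c" and "S \<noteq> 0 \<or> c \<noteq> 0"
  shows "\<exists>p. p \<noteq> 0 \<and> p\<^sup>2 - S * p + c = 0"
proof -
  define d where "d = sqrt (S\<^sup>2 - 4 * c)"
  have d: "d\<^sup>2 = S\<^sup>2 - 4 * c" using assms(1) by (simp add: d_def)
  have root: "((S + e) / 2)\<^sup>2 - S * ((S + e) / 2) + c = 0" if "e\<^sup>2 = S\<^sup>2 - 4 * c" for e
  proof -
    have "((S + e) / 2)\<^sup>2 - S * ((S + e) / 2) = (e\<^sup>2 - S\<^sup>2) / 4"
      by (simp add: power2_eq_square field_simps)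
    then show ?thesis by (simp only: that) simp
  qed
  have "S + d \<noteq> 0 \<or> S + (- d) \<noteq> 0" using assms(2) d by auto
  then obtain e where "e\<^sup>2 = S\<^sup>2 - 4 * c" "S + e \<noteq> 0" using d by (metis power2_minus)
  with root[of e] show ?thesis
    by (intro exI[of _ "(S + e) / 2"]) auto
qed

lemma cross_image_realI:
  fixes \<alpha> y :: "nat \<Rightarrow> real"
  assumes "S\<^sup>2 \<ge> 4 * ((sum y I - sum \<alpha> I * S) * (sum y J - sum \<alpha> J * S))"
    and "S \<noteq> 0 \<or> sum y I * sum y J \<noteq> 0"
  shows "y \<in> cross_image I J \<alpha>"
proof -
  have "S \<noteq> 0 \<or> (sum y I - sum \<alpha> I * S) * (sum y J - sum \<alpha> J * S) \<noteq> 0"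
    using assms(2) by auto
  from real_quadratic_nonzero_root[OF assms(1) this] show ?thesis
    using cross_imageI by blast
qed

text \<open>Here the discriminant \<open>A * S\<^sup>2 + B * S - C\<close> is nonnegative for some
  \<open>S \<noteq> 0\<close>: by its leading term if \<open>A > 0\<close>, by its linear term if \<open>A = 0\<close> and
  \<open>B \<noteq> 0\<close>. In the remaining case it is the constant \<open>- C\<close>, and \<open>A = B = 0\<close> force
  \<open>C \<le> 0\<close>: \<open>sum \<alpha> I\<close> and \<open>sum \<alpha> J\<close> have the same sign, while \<open>B = 0\<close>
  balances \<open>sum y I\<close> against \<open>sum y J\<close>.\<close>

lemma cross_image_real_full:
  fixes \<alpha> y :: "nat \<Rightarrow> real"
  assumes "4 * sum \<alpha> I * sum \<alpha> J \<le> 1"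
  shows "y \<in> cross_image I J \<alpha>"
proof -
  define A B C where "A = 1 - 4 * sum \<alpha> I * sum \<alpha> J"
    and "B = 4 * (sum \<alpha> I * sum y J + sum \<alpha> J * sum y I)" and "C = 4 * sum y I * sum y J"
  have disc: "S\<^sup>2 - 4 * ((sum y I - sum \<alpha> I * S) * (sum y J - sum \<alpha> J * S)) = A * S\<^sup>2 + B * S - C" for S
    by (simp add: A_def B_def C_def power2_eq_square algebra_simps)
  have "\<exists>S. S \<noteq> 0 \<and> A * S\<^sup>2 + B * S - C \<ge> 0"
  proof (cases "A = 0")
    case False
    then have A: "A > 0" using assms by (simp add: A_def)
    \<comment> \<open>Large enough that \<open>A * S\<close> outweighs \<open>B\<close> and leaves at least \<open>\<bar>C\<bar>\<close>.\<close>
    define S where "S = 1 + (\<bar>B\<bar> + \<bar>C\<bar>) / A"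
    have S: "S \<ge> 1" using A by (simp add: S_def)
    have AS: "A * S = A + \<bar>B\<bar> + \<bar>C\<bar>" using A by (simp add: S_def field_simps)
    have "\<bar>C\<bar> \<le> \<bar>C\<bar> * S" using S by (simp add: mult_le_cancel_left1)
    also have "\<dots> \<le> (A + \<bar>B\<bar> + \<bar>C\<bar> + B) * S" using S A by (intro mult_right_mono) auto
    also have "\<dots> = A * S\<^sup>2 + B * S" unfolding AS[symmetric] by (simp add: power2_eq_square algebra_simps)
    finally show ?thesis using S by (intro exI[of _ S]) auto
  next
    case A: True
    show ?thesis
    proof (cases "B = 0")
      case False
      show ?thesis
      proof (intro exI[of _ "(\<bar>C\<bar> + 1) / B"] conjI)
        show "A * ((\<bar>C\<bar> + 1) / B)\<^sup>2 + B * ((\<bar>C\<bar> + 1) / B) - C \<ge> 0"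
          using False A by simp
      qed (use False in auto)
    next
      case True
      have prod: "4 * (sum \<alpha> I * sum \<alpha> J) = 1" using A by (simp add: A_def)
      have lin: "sum \<alpha> I * sum y J = - (sum \<alpha> J * sum y I)" using True by (simp add: B_def)
      have "C = 4 * (4 * (sum \<alpha> I * sum \<alpha> J)) * sum y I * sum y J" by (simp add: prod C_def)
      also have "\<dots> = 16 * (sum \<alpha> J * sum y I) * (sum \<alpha> I * sum y J)" by simp
      also have "\<dots> = - (16 * (sum \<alpha> J * sum y I)\<^sup>2)" unfolding lin by (simp add: power2_eq_square)
      also have "\<dots> \<le> 0" by simp
      finally show ?thesis using A True by (intro exI[of _ 1]) auto
    qed
  qed
  then obtain S where "S \<noteq> 0" "A * S\<^sup>2 + B * S - C \<ge> 0" by blast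
  then show ?thesis by (intro cross_image_realI[where S = S]) (use disc[of S] in auto)
qed

text \<open>If the partial sums of \<open>y\<close> have opposite signs, the discriminant is already positive
  at \<open>S = 0\<close>. Otherwise it is evaluated at the vertex of the concave parabola, where it is
  positive; the vertex is not \<open>0\<close>, since the discriminant at \<open>0\<close> is
  \<open>- 4 * sum y I * sum y J \<le> 0\<close>.\<close>

lemma cross_image_real_nonzero_sum:
  fixes \<alpha> y :: "nat \<Rightarrow> real"
  assumes gt: "4 * sum \<alpha> I * sum \<alpha> J > 1" and nz: "sum y I \<noteq> 0 \<or> sum y J \<noteq> 0"
  shows "y \<in> cross_image I J \<alpha>"
proof (cases "sum y I * sum y J < 0")
  case True
  then show ?thesis by (intro cross_image_realI[where S = 0]) auto
next
  case False
  let ?A = "4 * sum \<alpha> I * sum \<alpha> J - 1"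
  let ?B = "sum \<alpha> I * sum y J + sum \<alpha> J * sum y I"
  let ?D = "\<lambda>S. S\<^sup>2 - 4 * ((sum y I - sum \<alpha> I * S) * (sum y J - sum \<alpha> J * S))"
  have A: "?A > 0" using gt by simp
  have nza: "sum \<alpha> I \<noteq> 0" "sum \<alpha> J \<noteq> 0" using gt by auto
  \<comment> \<open>\<open>?D\<close> is the parabola \<open>\<lambda>t. - ?A * t\<^sup>2 + 4 * ?B * t - 4 * sum y I * sum y J\<close>; its vertex is \<open>S\<close>.\<close>
  define S where "S = 2 * ?B / ?A"
  have SA: "?A * S = 2 * ?B" using A by (simp add: S_def)
  have "?A * ?D S = - (?A * S)\<^sup>2 + 4 * ?B * (?A * S) - 4 * ?A * (sum y I * sum y J)"
    by (simp add: power2_eq_square algebra_simps)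
  also have "\<dots> = 4 * ((sum \<alpha> I * sum y J - sum \<alpha> J * sum y I)\<^sup>2 + sum y I * sum y J)"
    unfolding SA by (simp add: power2_eq_square algebra_simps)
  also have "\<dots> > 0"
  proof (cases "sum y I * sum y J = 0")
    case True
    then have "sum \<alpha> I * sum y J - sum \<alpha> J * sum y I \<noteq> 0" using nz nza by auto
    then show ?thesis unfolding True by simp
  next
    case no: False
    have "sum y I * sum y J > 0" using False no by linarith
    then show ?thesis by (simp add: add_nonneg_pos)
  qed
  finally have D: "?D S > 0" using A by (simp add: zero_less_mult_iff)
  have "S \<noteq> 0"
  proof
    assume "S = 0"
    with D False show False by simp
  qed
  with D show ?thesis by (intro cross_image_realI[where S = S]) auto
qed

text \<open>With \<open>a = 0\<close>, \<open>b = 1\<close> and \<open>u = 0\<close> the equations have \<open>S = 0\<close> and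
  reduce to \<open>y = v\<close> on \<open>J\<close>; the other case is symmetric.\<close>

lemma cross_image_vanishing:
  fixes \<alpha> :: "nat \<Rightarrow> 'a :: field"
  assumes "(\<forall>k\<in>I. y k = 0) \<or> (\<forall>k\<in>J. y k = 0)"
  shows "y \<in> cross_image I J \<alpha>"
  using assms
proof
  assume "\<forall>k\<in>I. y k = 0"
  then show ?thesis unfolding cross_image_def
    by (intro CollectI exI[of _ 0] exI[of _ 1] exI[of _ "\<lambda>_. 0"] exI[of _ y]) auto
next
  assume "\<forall>k\<in>J. y k = 0"
  then show ?thesis unfolding cross_image_def
    by (intro CollectI exI[of _ 1] exI[of _ 0] exI[of _ y] exI[of _ "\<lambda>_. 0"]) auto
qed

text \<open>Summing the cross equations expresses \<open>a * sum u I\<close> and \<open>b * sum v J\<close> by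
  \<open>S\<close>. Substituted into \<open>a * b * S\<close>, this gives a quadratic form in \<open>a * b\<close> and
  \<open>S\<close> which is positive definite, as completing the square shows. Hence \<open>S = 0\<close> and
  \<open>a * b = 0\<close>.\<close>

lemma cross_image_real_zero_sums:
  fixes \<alpha> y :: "nat \<Rightarrow> real"
  assumes gt: "4 * sum \<alpha> I * sum \<alpha> J > 1" and zero: "sum y I = 0" "sum y J = 0"
    and y: "y \<in> cross_image I J \<alpha>"
  shows "(\<forall>k\<in>I. y k = 0) \<or> (\<forall>k\<in>J. y k = 0)"
proof -
  obtain a b u v where
    I': "\<forall>k\<in>I. y k = a * u k + \<alpha> k * (a * b + sum u I * sum v J)" and
    J': "\<forall>k\<in>J. y k = b * v k + \<alpha> k * (a * b + sum u I * sum v J)"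
    using y by (auto simp: cross_image_def)
  define S where S: "S = a * b + sum u I * sum v J"
  note I = I'[folded S] and J = J'[folded S]
  have sI: "a * sum u I = - (sum \<alpha> I * S)"
    using zero(1) I by (simp add: sum.distrib sum_distrib_left sum_distrib_right)
  have sJ: "b * sum v J = - (sum \<alpha> J * S)"
    using zero(2) J by (simp add: sum.distrib sum_distrib_left sum_distrib_right)
  have "a * b * S = (a * b)\<^sup>2 + (a * sum u I) * (b * sum v J)"
    by (simp add: S power2_eq_square algebra_simps)
  also have "\<dots> = (a * b)\<^sup>2 + sum \<alpha> I * sum \<alpha> J * S\<^sup>2"
    unfolding sI sJ by (simp add: power2_eq_square)
  finally have "(2 * (a * b) - S)\<^sup>2 + (4 * sum \<alpha> I * sum \<alpha> J - 1) * S\<^sup>2 = 0"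
    by (simp add: power2_eq_square algebra_simps)
  moreover have "(4 * sum \<alpha> I * sum \<alpha> J - 1) * S\<^sup>2 \<ge> 0" using gt by simp
  ultimately have "(4 * sum \<alpha> I * sum \<alpha> J - 1) * S\<^sup>2 = 0" "(2 * (a * b) - S)\<^sup>2 = 0"
    by (smt (verit) zero_le_power2)+
  then have "S = 0" "a * b = 0" using gt by auto
  then show ?thesis using I J by auto
qed

lemma cross_image_real_iff:
  fixes \<alpha> y :: "nat \<Rightarrow> real"
  assumes "4 * sum \<alpha> I * sum \<alpha> J > 1"
  shows "y \<in> cross_image I J \<alpha> \<longleftrightarrow>
    sum y I \<noteq> 0 \<or> sum y J \<noteq> 0 \<or> (\<forall>k\<in>I. y k = 0) \<or> (\<forall>k\<in>J. y k = 0)"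
  using cross_image_real_nonzero_sum[OF assms] cross_image_vanishing
    cross_image_real_zero_sums[OF assms] by blast

text \<open>Both index sets have at least two elements, so \<open>y\<close> can be chosen as
  \<open>(1, -1, 0, \<dots>, 0)\<close> on each of them: nonzero with vanishing sum.\<close>

lemma exists_not_in_cross_image:
  fixes \<alpha> :: "nat \<Rightarrow> real"
  assumes gt: "4 * (\<Sum>k=1..q-1. \<alpha> k) * (\<Sum>k=q..m. \<alpha> k) > 1" and "q > 2" and "m > q"
  shows "\<exists>y \<in> carrier_vec m. (\<lambda>k. y $ (k - 1)) \<notin> cross_image {1..q-1} {q..m} \<alpha>"
proof -
  define f :: "nat \<Rightarrow> real" where
    "f k = (if k = 1 then 1 else 0) - (if k = 2 then 1 else 0)
         + ((if k = q then 1 else 0) - (if k = q + 1 then 1 else 0))" for k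
  define y where "y = vec m (\<lambda>i. f (i + 1))"
  have y: "y $ (k - 1) = f k" if "k \<in> {1..m}" for k
    using that by (auto simp: y_def)
  have "(\<Sum>k=1..q-1. y $ (k - 1)) = (\<Sum>k=1..q-1. f k)" "(\<Sum>k=q..m. y $ (k - 1)) = (\<Sum>k=q..m. f k)"
    using assms by (auto intro!: sum.cong y[unfolded One_nat_def])
  moreover have "(\<Sum>k=1..q-1. f k) = 0" "(\<Sum>k=q..m. f k) = 0"
    unfolding f_def sum.distrib sum_subtractf using assms by auto
  moreover have "y $ (1 - 1) \<noteq> 0" "y $ (q - 1) \<noteq> 0"
    using assms y[of 1] y[of q] by (auto simp: f_def)
  moreover have "1 \<in> {1..q-1}" "q \<in> {q..m}" using assms by auto
  ultimately have "(\<lambda>k. y $ (k - 1)) \<notin> cross_image {1..q-1} {q..m} \<alpha>"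
    unfolding cross_image_real_iff[OF gt] by metis
  then show ?thesis by (intro bexI[of _ y]) (auto simp: y_def)
qed

theorem lemma3p19:
  fixes n q m r s :: nat
  assumes "n > 2" and "q > 2" and "m = n + q - 2"
    and "1 \<le> r" and "r \<le> n" and "1 \<le> s" and "s \<le> q"
  shows
    "(\<forall>(F :: complex mat \<Rightarrow> complex mat) L L0 M \<alpha> coef.
        cross_setting n q m r s F L L0 M \<alpha> coef \<longrightarrow>
        Y_set n q (A_hat n q m coef) = carrier_vec m) \<and>
     (\<forall>(F :: real mat \<Rightarrow> real mat) L L0 M \<alpha> coef \<alpha>1 \<alpha>2.
        cross_setting n q m r s F L L0 M \<alpha> coef \<longrightarrow>
        \<alpha>1 = (\<Sum>k=1..q-1. \<alpha> k) \<longrightarrow>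
        \<alpha>2 = (\<Sum>k=q..m. \<alpha> k) \<longrightarrow>
        (Y_set n q (A_hat n q m coef) = carrier_vec m \<longleftrightarrow> 4 * \<alpha>1 * \<alpha>2 \<le> 1) \<and>
        (4 * \<alpha>1 * \<alpha>2 > 1 \<longrightarrow>
           Y_set n q (A_hat n q m coef) =
             {y \<in> carrier_vec m.
                (\<Sum>k=1..q-1. y $ (k - 1)) \<noteq> 0 \<or>
                (\<Sum>k=q..m. y $ (k - 1)) \<noteq> 0 \<or>
                (\<Sum>k=1..q-1. \<bar>y $ (k - 1)\<bar>) = 0 \<or>
                (\<Sum>k=q..m. \<bar>y $ (k - 1)\<bar>) = 0}))"
proof (intro conjI allI impI)
  fix F :: "complex mat \<Rightarrow> complex mat" and L L0 M \<alpha> coef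
  assume set: "cross_setting n q m r s F L L0 M \<alpha> coef"
  show "Y_set n q (A_hat n q m coef) = carrier_vec m"
    by (simp add: cross_Y_set[OF set assms(3,1,2,4-7)] cross_image_complex)
next
  fix F :: "real mat \<Rightarrow> real mat" and L L0 M \<alpha> coef \<alpha>1 \<alpha>2
  assume set: "cross_setting n q m r s F L L0 M \<alpha> coef"
    and \<alpha>1: "\<alpha>1 = (\<Sum>k=1..q-1. \<alpha> k)" and \<alpha>2: "\<alpha>2 = (\<Sum>k=q..m. \<alpha> k)"
  note Y = cross_Y_set[OF set assms(3,1,2,4-7)]
  show "Y_set n q (A_hat n q m coef) = carrier_vec m \<longleftrightarrow> 4 * \<alpha>1 * \<alpha>2 \<le> 1"
  proof
    assume full: "Y_set n q (A_hat n q m coef) = carrier_vec m"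
    show "4 * \<alpha>1 * \<alpha>2 \<le> 1"
    proof (rule ccontr)
      assume "\<not> 4 * \<alpha>1 * \<alpha>2 \<le> 1"
      then have "\<exists>y \<in> carrier_vec m. (\<lambda>k. y $ (k - 1)) \<notin> cross_image {1..q-1} {q..m} \<alpha>"
        using assms(1-3) unfolding \<alpha>1 \<alpha>2 by (intro exists_not_in_cross_image) auto
      with full Y show False by auto
    qed
  next
    assume "4 * \<alpha>1 * \<alpha>2 \<le> 1"
    then show "Y_set n q (A_hat n q m coef) = carrier_vec m"
      unfolding Y \<alpha>1 \<alpha>2 by (simp add: cross_image_real_full)
  qed
  assume "4 * \<alpha>1 * \<alpha>2 > 1"
  then have gt: "4 * sum \<alpha> {1..q-1} * sum \<alpha> {q..m} > 1" by (simp add: \<alpha>1 \<alpha>2)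
  show "Y_set n q (A_hat n q m coef) =
             {y \<in> carrier_vec m.
                (\<Sum>k=1..q-1. y $ (k - 1)) \<noteq> 0 \<or>
                (\<Sum>k=q..m. y $ (k - 1)) \<noteq> 0 \<or>
                (\<Sum>k=1..q-1. \<bar>y $ (k - 1)\<bar>) = 0 \<or>
                (\<Sum>k=q..m. \<bar>y $ (k - 1)\<bar>) = 0}"
    unfolding Y cross_image_real_iff[OF gt] by (simp add: sum_nonneg_eq_0_iff)
qed

end
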